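(* Let $W\in\mathbb{R}^{n\times n}$ be symmetric positive definite, let $T\in\mathbb{R}^{n\times n}$ be symmetric positive semidefinite, and let $$0=\mu_1=\cdots=\mu_{s-1}<\mu_s\leqslant\cdots\leqslant\mu_n$$ be the eigenvalues (counted with multiplicity) of $S=W^{-\frac12}TW^{-\frac12}$. Then the TTSCSP iteration method with parameters $\alpha,\beta$ is convergent if $\alpha$ and $\beta$ satisfy $$0<\beta<\alpha,\qquad \alpha>\frac12\left(\frac{1}{\mu_s}-\mu_s\right)\qquad\text{and}\qquad \beta>\frac12\left(\mu_n-\frac{1}{\mu_n}\right).$$
   Context: Consider the complex linear system $Au=(W+iT)u=b$, $b\in\mathbb{C}^n$, $i=\sqrt{-1}$. For positive numbers $\alpha,\beta$, the TTSCSP (two-parameter two-step scale-splitting) iteration method starts from an arbitrary $u^{(0)}\in\mathbb{C}^n$ and computes, for $k=0,1,2,\ldots$, $$(\alpha W+T)u^{(k+\frac12)}=i(W-\alpha T)u^{(k)}+(\alpha-i)b,$$ $$(W+\beta T)u^{(k+1)}=i(\beta W-T)u^{(k+\frac12)}+(1-\beta i)b.$$ Its iteration matrix is $\mathcal{G}_{\alpha,\beta}=(W+\beta T)^{-1}(T-\beta W)(\alpha W+T)^{-1}(W-\alpha T)$, i.e. $u^{(k+1)}=\mathcal{G}_{\alpha,\beta}u^{(k)}+\mathcal{C}_{\alpha,\beta}$ for a fixed vector $\mathcal{C}_{\alpha,\beta}$. The method is called convergent if $\rho(\mathcal{G}_{\alpha,\beta})<1$, where $\rho$ denotes the spectral radius.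 In the eigenvalue list, $\mu_s$ is the smallest nonzero eigenvalue of $S$ (so $s\le n$) and $\mu_n$ the largest. *)

theory Defs
  imports
    "Jordan_Normal_Form.Spectral_Radius"
    "Jordan_Normal_Form.Gauss_Jordan_Elimination"
begin

definition sym_pos_def :: "nat \<Rightarrow> real mat \<Rightarrow> bool" where
  "sym_pos_def n A \<longleftrightarrow> A \<in> carrier_mat n n \<and> A\<^sup>T = A \<and>
     (\<forall>x \<in> carrier_vec n. x \<noteq> 0\<^sub>v n \<longrightarrow> 0 < x \<bullet> (A *\<^sub>v x))"

definition sym_pos_semidef :: "nat \<Rightarrow> real mat \<Rightarrow> bool" where
  "sym_pos_semidef n A \<longleftrightarrow> A \<in> carrier_mat n n \<and> A\<^sup>T = A \<and>
     (\<forall>x \<in> carrier_vec n. 0 \<le> x \<bullet> (A *\<^sub>v x))"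

(* Unspecified for singular matrices; only applied to invertible ones below. *)
definition mat_inv :: "real mat \<Rightarrow> real mat" where
  "mat_inv A = the (mat_inverse A)"

(* The principal square root: the unique symmetric positive semidefinite R with R * R = W.
   It exists and is unique whenever W is itself symmetric positive semidefinite. *)
definition mat_sqrt :: "real mat \<Rightarrow> real mat" where
  "mat_sqrt W = (THE R. sym_pos_semidef (dim_row W) R \<and> R * R = W)"

abbreviation cmat :: "real mat \<Rightarrow> complex mat" where
  "cmat \<equiv> map_mat complex_of_real"

(* One TTSCSP iteration for (W + iT) u = b, leading from the iterate u to the next iterate u'
   through the intermediate vector v. *)
definition ttscsp_step ::
  "real mat \<Rightarrow> real mat \<Rightarrow> complex vec \<Rightarrow> real \<Rightarrow> real \<Rightarrow> complex vec \<Rightarrow> complex vec \<Rightarrow> bool" where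
  "ttscsp_step W T b \<alpha> \<beta> u u' \<longleftrightarrow> u' \<in> carrier_vec (dim_row W) \<and>
     (\<exists>v \<in> carrier_vec (dim_row W).
        cmat (\<alpha> \<cdot>\<^sub>m W + T) *\<^sub>v v =
          \<i> \<cdot>\<^sub>v (cmat (W - \<alpha> \<cdot>\<^sub>m T) *\<^sub>v u) + (complex_of_real \<alpha> - \<i>) \<cdot>\<^sub>v b \<and>
        cmat (W + \<beta> \<cdot>\<^sub>m T) *\<^sub>v u' =
          \<i> \<cdot>\<^sub>v (cmat (\<beta> \<cdot>\<^sub>m W - T) *\<^sub>v v) + (1 - complex_of_real \<beta> * \<i>) \<cdot>\<^sub>v b)"

definition ttscsp_iteration_mat :: "real mat \<Rightarrow> real mat \<Rightarrow> real \<Rightarrow> real \<Rightarrow> real mat" where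
  "ttscsp_iteration_mat W T \<alpha> \<beta> =
     mat_inv (W + \<beta> \<cdot>\<^sub>m T) * (T - \<beta> \<cdot>\<^sub>m W) * mat_inv (\<alpha> \<cdot>\<^sub>m W + T) * (W - \<alpha> \<cdot>\<^sub>m T)"

(* The iteration matrix is real, but its spectral radius ranges over its complex eigenvalues. *)
definition ttscsp_convergent :: "real mat \<Rightarrow> real mat \<Rightarrow> real \<Rightarrow> real \<Rightarrow> bool" where
  "ttscsp_convergent W T \<alpha> \<beta> \<longleftrightarrow> spectral_radius (cmat (ttscsp_iteration_mat W T \<alpha> \<beta>)) < 1"

lemma smult_mat_mult_vec:
  "v \<in> carrier_vec (dim_col A) \<Longrightarrow> (c \<cdot>\<^sub>m A) *\<^sub>v v = c \<cdot>\<^sub>v (A *\<^sub>v (v :: 'a :: comm_ring_1 vec))"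
  by (intro eq_vecI) (auto simp: row_smult)

lemma sym_pos_def_combination:
  assumes W: "sym_pos_def n W" and T: "sym_pos_semidef n T" and a: "(a::real) > 0" and c: "c \<ge> 0"
  shows "sym_pos_def n (a \<cdot>\<^sub>m W + c \<cdot>\<^sub>m T)"
proof -
  have Wc: "W \<in> carrier_mat n n" "W\<^sup>T = W" and Tc: "T \<in> carrier_mat n n" "T\<^sup>T = T"
    using W T by (auto simp: sym_pos_def_def sym_pos_semidef_def)
  have sym: "(a \<cdot>\<^sub>m W + c \<cdot>\<^sub>m T)\<^sup>T = a \<cdot>\<^sub>m W + c \<cdot>\<^sub>m T"
  proof (rule eq_matI)
    fix i j assume "i < dim_row (a \<cdot>\<^sub>m W + c \<cdot>\<^sub>m T)" "j < dim_col (a \<cdot>\<^sub>m W + c \<cdot>\<^sub>m T)"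
    hence ij: "i < n" "j < n" using Wc Tc by auto
    have "W $$ (j, i) = W\<^sup>T $$ (i, j)" "T $$ (j, i) = T\<^sup>T $$ (i, j)"
      using ij Wc(1) Tc(1) by auto
    thus "(a \<cdot>\<^sub>m W + c \<cdot>\<^sub>m T)\<^sup>T $$ (i, j) = (a \<cdot>\<^sub>m W + c \<cdot>\<^sub>m T) $$ (i, j)"
      using ij Wc Tc by auto
  qed (use Wc Tc in auto)
  have "0 < x \<bullet> ((a \<cdot>\<^sub>m W + c \<cdot>\<^sub>m T) *\<^sub>v x)" if x: "x \<in> carrier_vec n" "x \<noteq> 0\<^sub>v n" for x
  proof -
    have "(a \<cdot>\<^sub>m W + c \<cdot>\<^sub>m T) *\<^sub>v x = a \<cdot>\<^sub>v (W *\<^sub>v x) + c \<cdot>\<^sub>v (T *\<^sub>v x)"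
      using x Wc Tc
      by (subst add_mult_distrib_mat_vec[where nr = n and nc = n])
        (auto simp: smult_mat_mult_vec)
    hence "x \<bullet> ((a \<cdot>\<^sub>m W + c \<cdot>\<^sub>m T) *\<^sub>v x) = a * (x \<bullet> (W *\<^sub>v x)) + c * (x \<bullet> (T *\<^sub>v x))"
      using x Wc Tc by (simp add: scalar_prod_add_distrib[where n = n])
    moreover have "0 < x \<bullet> (W *\<^sub>v x)" "0 \<le> x \<bullet> (T *\<^sub>v x)"
      using W T x by (auto simp: sym_pos_def_def sym_pos_semidef_def)
    ultimately show ?thesis using a c by (simp add: add_pos_nonneg)
  qed
  with sym Wc Tc show ?thesis by (auto simp: sym_pos_def_def)
qed

lemma sym_pos_def_mat_inv:
  assumes A: "sym_pos_def n A"
  shows "mat_inv A \<in> carrier_mat n n" "A * mat_inv A = 1\<^sub>m n" "mat_inv A * A = 1\<^sub>m n"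
proof -
  have Ac: "A \<in> carrier_mat n n" using A by (simp add: sym_pos_def_def)
  have "det A \<noteq> 0"
  proof
    assume "det A = 0"
    then obtain v where "v \<in> carrier_vec n" "v \<noteq> 0\<^sub>v n" "A *\<^sub>v v = 0\<^sub>v n"
      using det_0_iff_vec_prod_zero_field[OF Ac] by auto
    thus False using A by (auto simp: sym_pos_def_def)
  qed
  from det_non_zero_imp_unit[OF Ac this, of "()"] mat_inverse(1)[OF Ac, of "()"]
  obtain B where "mat_inverse A = Some B" by (cases "mat_inverse A") auto
  with mat_inverse(2)[OF Ac this]
  show "mat_inv A \<in> carrier_mat n n" "A * mat_inv A = 1\<^sub>m n" "mat_inv A * A = 1\<^sub>m n"
    by (auto simp: mat_inv_def)
qed

lemma sym_pos_def_cmat_solve: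
  assumes A: "sym_pos_def n A" and x: "x \<in> carrier_vec n" and r: "r \<in> carrier_vec n"
  shows "cmat A *\<^sub>v x = r \<longleftrightarrow> x = cmat (mat_inv A) *\<^sub>v r"
proof -
  note inv = sym_pos_def_mat_inv[OF A]
  have Ac: "A \<in> carrier_mat n n" using A by (simp add: sym_pos_def_def)
  have one: "cmat A * cmat (mat_inv A) = 1\<^sub>m n" "cmat (mat_inv A) * cmat A = 1\<^sub>m n"
    using of_real_hom.mat_hom_mult[OF Ac inv(1)] of_real_hom.mat_hom_mult[OF inv(1) Ac] inv(2,3)
    by (metis of_real_hom.mat_hom_one)+
  have c: "cmat A \<in> carrier_mat n n" "cmat (mat_inv A) \<in> carrier_mat n n" using Ac inv(1) by auto
  have "cmat (mat_inv A) *\<^sub>v (cmat A *\<^sub>v x) = x" "cmat A *\<^sub>v (cmat (mat_inv A) *\<^sub>v r) = r"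
    using one x r by (simp_all flip: assoc_mult_mat_vec[OF c(2,1) x] assoc_mult_mat_vec[OF c(1,2) r])
  thus ?thesis by auto
qed

theorem ttscsp_step_iteration_mat:
  assumes W: "sym_pos_def n W" and T: "sym_pos_semidef n T" and b: "b \<in> carrier_vec n"
    and pos: "0 < \<alpha>" "0 < \<beta>"
  shows "\<exists>C \<in> carrier_vec n. \<forall>u \<in> carrier_vec n. \<forall>u'.
    ttscsp_step W T b \<alpha> \<beta> u u' \<longleftrightarrow> u' = cmat (ttscsp_iteration_mat W T \<alpha> \<beta>) *\<^sub>v u + C"
proof -
  have Wc: "W \<in> carrier_mat n n" and Tc: "T \<in> carrier_mat n n"
    using W T by (auto simp: sym_pos_def_def sym_pos_semidef_def)
  have one: "1 \<cdot>\<^sub>m W = W" "1 \<cdot>\<^sub>m T = T" by auto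
  define P where "P = \<alpha> \<cdot>\<^sub>m W + T"
  define Q where "Q = W + \<beta> \<cdot>\<^sub>m T"
  define K where "K = W - \<alpha> \<cdot>\<^sub>m T"
  define L where "L = \<beta> \<cdot>\<^sub>m W - T"
  have P: "sym_pos_def n P" and Q: "sym_pos_def n Q"
    using sym_pos_def_combination[OF W T, of \<alpha> 1] sym_pos_def_combination[OF W T, of 1 \<beta>] pos
    by (auto simp: P_def Q_def one)
  define Pi Qi where "Pi = cmat (mat_inv P)" and "Qi = cmat (mat_inv Q)"
  define cK cL where "cK = cmat K" and "cL = cmat L"
  have c: "Pi \<in> carrier_mat n n" "Qi \<in> carrier_mat n n" "cK \<in> carrier_mat n n" "cL \<in> carrier_mat n n"
    using sym_pos_def_mat_inv(1)[OF P] sym_pos_def_mat_inv(1)[OF Q] Wc Tc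
    by (auto simp: Pi_def Qi_def cK_def cL_def K_def L_def)
  define p q where "p = complex_of_real \<alpha> - \<i>" and "q = 1 - complex_of_real \<beta> * \<i>"
  define C where "C = Qi *\<^sub>v (\<i> \<cdot>\<^sub>v (cL *\<^sub>v (Pi *\<^sub>v (p \<cdot>\<^sub>v b))) + q \<cdot>\<^sub>v b)"
  have Cc: "C \<in> carrier_vec n" using c b by (auto simp: C_def)
  have neg: "T - \<beta> \<cdot>\<^sub>m W = (-1) \<cdot>\<^sub>m L" using Wc Tc by (intro eq_matI) (auto simp: L_def)
  have G: "cmat (ttscsp_iteration_mat W T \<alpha> \<beta>) = Qi * ((-1) \<cdot>\<^sub>m cL) * Pi * cK"
  proof -
    have Lc: "(-1) \<cdot>\<^sub>m L \<in> carrier_mat n n" "K \<in> carrier_mat n n"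
      using Wc Tc by (auto simp: L_def K_def)
    have "cmat ((-1) \<cdot>\<^sub>m L) = (-1) \<cdot>\<^sub>m cL"
      by (intro eq_matI) (auto simp: cL_def)
    moreover have "mat_inv Q * ((-1) \<cdot>\<^sub>m L) \<in> carrier_mat n n"
      "mat_inv Q * ((-1) \<cdot>\<^sub>m L) * mat_inv P \<in> carrier_mat n n"
      using sym_pos_def_mat_inv(1)[OF P] sym_pos_def_mat_inv(1)[OF Q] Lc by auto
    ultimately show ?thesis
      unfolding ttscsp_iteration_mat_def neg P_def[symmetric] Q_def[symmetric] K_def[symmetric]
      using sym_pos_def_mat_inv(1)[OF P] sym_pos_def_mat_inv(1)[OF Q] Lc
      by (simp add: of_real_hom.mat_hom_mult[where nr = n and n = n and nc = n]
          Pi_def Qi_def cK_def del: assoc_mult_mat)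
  qed
  have "ttscsp_step W T b \<alpha> \<beta> u u' \<longleftrightarrow> u' = cmat (ttscsp_iteration_mat W T \<alpha> \<beta>) *\<^sub>v u + C"
    if u: "u \<in> carrier_vec n" for u u'
  proof -
    define v where "v = Pi *\<^sub>v (\<i> \<cdot>\<^sub>v (cK *\<^sub>v u) + p \<cdot>\<^sub>v b)"
    define w where "w = Qi *\<^sub>v (\<i> \<cdot>\<^sub>v (cL *\<^sub>v v) + q \<cdot>\<^sub>v b)"
    have vw: "v \<in> carrier_vec n" "w \<in> carrier_vec n" using c u b by (auto simp: v_def w_def)
    have "ttscsp_step W T b \<alpha> \<beta> u u' \<longleftrightarrow> u' \<in> carrier_vec n \<and> (\<exists>x \<in> carrier_vec n.
        cmat P *\<^sub>v x = \<i> \<cdot>\<^sub>v (cK *\<^sub>v u) + p \<cdot>\<^sub>v b \<and>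
        cmat Q *\<^sub>v u' = \<i> \<cdot>\<^sub>v (cL *\<^sub>v x) + q \<cdot>\<^sub>v b)"
      using Wc by (simp add: ttscsp_step_def P_def Q_def K_def L_def cK_def cL_def p_def q_def)
    also have "\<dots> \<longleftrightarrow> u' \<in> carrier_vec n \<and> (\<exists>x \<in> carrier_vec n. x = v \<and>
        u' = Qi *\<^sub>v (\<i> \<cdot>\<^sub>v (cL *\<^sub>v x) + q \<cdot>\<^sub>v b))"
      using c u b sym_pos_def_cmat_solve[OF P] sym_pos_def_cmat_solve[OF Q]
      unfolding v_def Pi_def Qi_def by (intro conj_cong bex_cong refl) auto
    also have "\<dots> \<longleftrightarrow> u' = w" using vw by (auto simp: w_def)
    also have "w = cmat (ttscsp_iteration_mat W T \<alpha> \<beta>) *\<^sub>v u + C"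
    proof -
      define y where "y = Pi *\<^sub>v (cK *\<^sub>v u)"
      define z where "z = Pi *\<^sub>v (p \<cdot>\<^sub>v b)"
      have yz: "y \<in> carrier_vec n" "z \<in> carrier_vec n" using c u b by (auto simp: y_def z_def)
      have v: "v = \<i> \<cdot>\<^sub>v y + z"
        using c u b by (simp add: v_def y_def z_def mult_add_distrib_mat_vec[OF c(1)]
            mult_mat_vec[OF c(1)])
      have "\<i> \<cdot>\<^sub>v (cL *\<^sub>v v) + q \<cdot>\<^sub>v b = (-1) \<cdot>\<^sub>v (cL *\<^sub>v y) + (\<i> \<cdot>\<^sub>v (cL *\<^sub>v z) + q \<cdot>\<^sub>v b)"
      proof -
        have "cL *\<^sub>v v = \<i> \<cdot>\<^sub>v (cL *\<^sub>v y) + cL *\<^sub>v z"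
          unfolding v using c yz by (simp add: mult_add_distrib_mat_vec[OF c(4)] mult_mat_vec[OF c(4)])
        thus ?thesis using c yz b by (intro eq_vecI) (auto simp: algebra_simps)
      qed
      hence "w = Qi *\<^sub>v ((-1) \<cdot>\<^sub>v (cL *\<^sub>v y)) + C"
        using c yz b by (simp add: w_def C_def z_def mult_add_distrib_mat_vec[OF c(2)])
      moreover have "cmat (ttscsp_iteration_mat W T \<alpha> \<beta>) *\<^sub>v u = Qi *\<^sub>v ((-1) \<cdot>\<^sub>v (cL *\<^sub>v y))"
      proof -
        have m: "(-1) \<cdot>\<^sub>m cL \<in> carrier_mat n n" "Qi * ((-1) \<cdot>\<^sub>m cL) \<in> carrier_mat n n"
          "Qi * ((-1) \<cdot>\<^sub>m cL) * Pi \<in> carrier_mat n n" "cK *\<^sub>v u \<in> carrier_vec n"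
          using c u by auto
        show ?thesis unfolding G assoc_mult_mat_vec[OF m(3) c(3) u] assoc_mult_mat_vec[OF m(2) c(1) m(4)]
          assoc_mult_mat_vec[OF c(2) m(1) yz(1)[unfolded y_def]]
          using c yz by (simp add: y_def smult_mat_mult_vec)
      qed
      ultimately show ?thesis by simp
    qed
    finally show ?thesis .
  qed
  with Cc show ?thesis by blast
qed

end

theory Submission
  imports Defs "Jordan_Normal_Form.Jordan_Normal_Form_Existence"
begin

text \<open>The matrices \<open>W\<close> and \<open>T\<close> can be diagonalized simultaneously by an equivalence. Let
\<open>R\<close> be the principal square root of \<open>W\<close>. The symmetric matrix \<open>S = R\<inverse> T R\<inverse>\<close> has
the form \<open>P \<Delta> P\<inverse>\<close> with \<open>\<Delta>\<close> diagonal, and then \<open>W = (R P) (P\<inverse> R)\<close> and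
\<open>T = (R P) \<Delta> (P\<inverse> R)\<close> (\<open>pencil_simultaneous_diagonalization\<close>). Each of the four
factors of the iteration matrix is a combination \<open>a W + b T\<close> or the inverse of one, so the outer
factors cancel and the iteration matrix is similar to a diagonal matrix, whose entry for an eigenvalue
\<open>m\<close> of \<open>S\<close> is
\<open>\<kappa>(m) = (m - \<beta>) (1 - \<alpha> m) / ((1 + \<beta> m) (\<alpha> + m))\<close>.

Write \<open>N\<close> for the numerator and \<open>D\<close> for the positive denominator. Then
\<open>D - N = (\<alpha> + \<beta>) (1 + m\<^sup>2) > 0\<close>, and
\<open>D + N = (\<alpha> - \<beta>) (1 - m\<^sup>2) + 2 m (1 + \<alpha> \<beta>)\<close>. The latter is clearly positive for
\<open>0 \<le> m \<le> 1\<close>; for \<open>m > 1\<close> the bound \<open>m\<^sup>2 - 1 < 2 m \<beta>\<close> makes the negative term smaller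
than the positive one (\<open>ttscsp_factor_less_1\<close>). Since \<open>m - 1 / m\<close> increases with \<open>m\<close>,
that bound holds for all positive eigenvalues once it holds for the largest.

Behind this stand two facts on real symmetric matrices: they are diagonalizable over the reals
(\<open>symmetric_diagonalizable\<close>), and positive semidefinite ones have exactly one positive
semidefinite square root (\<open>mat_sqrt\<close>).\<close>

section \<open>Diagonalization of real symmetric matrices\<close>

lemma real_scalar_prod_self:
  fixes v :: "real vec"
  shows "0 \<le> v \<bullet> v" and "v \<in> carrier_vec n \<Longrightarrow> v \<bullet> v = 0 \<longleftrightarrow> v = 0\<^sub>v n"
proof -
  have c: "conjugate v = v" by (intro eq_vecI) auto
  show "0 \<le> v \<bullet> v" using conjugate_square_ge_0_vec[of v] by (simp add: c)
  show "v \<bullet> v = 0 \<longleftrightarrow> v = 0\<^sub>v n" if "v \<in> carrier_vec n"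
    using conjugate_square_eq_0_vec[OF that] by (simp add: c)
qed

lemma symmetric_mat_self_adjoint:
  assumes "A \<in> carrier_mat n n" "A\<^sup>T = (A :: 'a :: comm_semiring_0 mat)"
    and "x \<in> carrier_vec n" "y \<in> carrier_vec n"
  shows "x \<bullet> (A *\<^sub>v y) = (A *\<^sub>v x) \<bullet> y"
  using transpose_vec_mult_scalar[OF assms(1,4,3)] assms(2) by simp

text \<open>If \<open>A x = k x\<close>, then \<open>A\<close> maps the conjugate of \<open>x\<close> to its multiple by the conjugate
of \<open>k\<close>, because \<open>A\<close> is real. By symmetry both factors agree on the nonzero number \<open>x \<bullet>c x\<close>.\<close>

lemma symmetric_eigenvalue_real:
  assumes A: "A \<in> carrier_mat n n" "A\<^sup>T = A" and k: "eigenvalue (cmat A) k"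
  shows "k \<in> \<real>"
proof -
  have "(cmat A)\<^sup>T = cmat (A\<^sup>T)" by (intro eq_matI) auto
  hence Ac: "cmat A \<in> carrier_mat n n" "(cmat A)\<^sup>T = cmat A" using A by auto
  obtain x where x: "x \<in> carrier_vec n" "x \<noteq> 0\<^sub>v n" "cmat A *\<^sub>v x = k \<cdot>\<^sub>v x"
    using k Ac(1) unfolding eigenvalue_def eigenvector_def by auto
  have cx: "conjugate x \<in> carrier_vec n" using x by simp
  have "cmat A *\<^sub>v conjugate x = conjugate (cmat A *\<^sub>v x)"
    using A(1) x(1) by (intro eq_vecI) (auto simp: scalar_prod_def)
  also have "\<dots> = cnj k \<cdot>\<^sub>v conjugate x" unfolding x(3) using x by (intro eq_vecI) auto
  finally have "x \<bullet> (cmat A *\<^sub>v conjugate x) = cnj k * (x \<bullet>c x)"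
    using x by simp
  moreover have "x \<bullet> (cmat A *\<^sub>v conjugate x) = k * (x \<bullet>c x)"
    using symmetric_mat_self_adjoint[OF Ac x(1) cx] x by simp
  moreover have "x \<bullet>c x \<noteq> 0" using x by simp
  ultimately have "cnj k = k" by simp
  thus ?thesis by (simp add: Reals_cnj_iff)
qed

text \<open>Over the complex numbers every characteristic polynomial splits; here all its roots are real,
and the embedding of real into complex polynomials is injective.\<close>

lemma symmetric_char_poly_splits:
  assumes A: "A \<in> carrier_mat n n" "A\<^sup>T = (A :: real mat)"
  shows "\<exists>es. char_poly A = (\<Prod>e\<leftarrow>es. [:- e, 1:])"
proof -
  interpret h: map_poly_inj_comm_ring_hom complex_of_real ..
  have Ac: "cmat A \<in> carrier_mat n n" using A by simp
  obtain as where as: "char_poly (cmat A) = (\<Prod>a\<leftarrow>as. [:- a, 1:])"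
    using char_poly_factorized[OF Ac] by auto
  have "a \<in> \<real>" if "a \<in> set as" for a
  proof (rule symmetric_eigenvalue_real[OF A])
    show "eigenvalue (cmat A) a"
      unfolding eigenvalue_root_char_poly[OF Ac] as using that
      by (auto simp: poly_prod_list prod_list_zero_iff)
  qed
  hence re: "complex_of_real (Re a) = a" if "a \<in> set as" for a using that by simp
  have "map_poly complex_of_real (char_poly A) = (\<Prod>a\<leftarrow>as. [:- a, 1:])"
    using as A by (simp add: of_real_hom.char_poly_hom)
  also have "\<dots> = (\<Prod>a\<leftarrow>as. map_poly complex_of_real [:- Re a, 1:])"
    by (intro arg_cong[where f = prod_list] map_cong refl) (simp add: re)
  also have "\<dots> = map_poly complex_of_real (\<Prod>a\<leftarrow>map Re as. [:- a, 1:])"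
    by (simp add: h.hom_prod_list o_def)
  finally show ?thesis by (metis h.eq_iff)
qed

lemma invertible_mat_col_nonzero:
  fixes P :: "'a :: comm_ring_1 mat"
  assumes c: "P \<in> carrier_mat n n" "Q \<in> carrier_mat n n" "Q * P = 1\<^sub>m n" and i: "i < n"
  shows "col P i \<noteq> 0\<^sub>v n"
proof
  assume z: "col P i = 0\<^sub>v n"
  have "(Q * P) $$ (i, i) = row Q i \<bullet> col P i" using i c(1,2) by simp
  also have "\<dots> = 0" unfolding z using i c(2) by simp
  finally show False unfolding c(3) using i by simp
qed

text \<open>The ones above the diagonal stay within one Jordan block and so join equal diagonal values.
This describes Jordan matrices by their entries, without reference to the list of blocks.\<close>

lemma jordan_matrix_bidiagonal:
  assumes "i < sum_list (map fst n_as)" "j < sum_list (map fst n_as)"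
    and "jordan_matrix n_as $$ (i, j) \<noteq> (0 :: 'a :: zero_neq_one)"
  shows "i = j \<or> j = Suc i \<and> jordan_matrix n_as $$ (i, i) = jordan_matrix n_as $$ (j, j)"
  using assms
proof (induction n_as arbitrary: i j)
  case (Cons na n_as)
  obtain m a where na: "na = (m, a)" by force
  show ?case
  proof (cases "i < m \<or> j < m")
    case True
    thus ?thesis using Cons.prems
      by (auto simp: na jordan_matrix_Cons split: if_splits)
  next
    case False
    hence "i - m = j - m \<or> j - m = Suc (i - m) \<and>
        jordan_matrix n_as $$ (i - m, i - m) = jordan_matrix n_as $$ (j - m, j - m)"
      using Cons.prems by (intro Cons.IH) (auto simp: na jordan_matrix_Cons)
    thus ?thesis using False Cons.prems by (auto simp: na jordan_matrix_Cons)
  qed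
qed simp

text \<open>Let \<open>A = P J P\<inverse>\<close> with \<open>J\<close> in Jordan form. Symmetry of \<open>A\<close> means that the Gram
matrix \<open>K = P\<^sup>T P\<close> satisfies \<open>K J = J\<^sup>T K\<close>. At the start of a Jordan block of size at least
two, this identity compares \<open>K\<^sub>i\<^sub>i\<close> with zero, although \<open>K\<^sub>i\<^sub>i\<close> is the squared length of a
column of \<open>P\<close>. So all blocks have size one.\<close>

lemma symmetric_diagonalizable:
  assumes A: "A \<in> carrier_mat n n" "A\<^sup>T = (A :: real mat)"
  shows "\<exists>P Q d. P \<in> carrier_mat n n \<and> Q \<in> carrier_mat n n \<and> P * Q = 1\<^sub>m n \<and> Q * P = 1\<^sub>m n
    \<and> A = P * mat_diag n d * Q"
proof -
  obtain es where "char_poly A = (\<Prod>e\<leftarrow>es. [:- e, 1:])" using symmetric_char_poly_splits[OF A] by blast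
  then obtain n_as where "jordan_nf A n_as" using jordan_nf_exists[OF A(1)] by blast
  hence "similar_mat A (jordan_matrix n_as)" by (simp add: jordan_nf_def)
  then obtain P Q where wit: "similar_mat_wit A (jordan_matrix n_as) P Q" unfolding similar_mat_def by blast
  define J where "J = jordan_matrix n_as"
  note PQ = similar_mat_witD2[OF A(1) wit, folded J_def]
  have n: "sum_list (map fst n_as) = n" using PQ(5) unfolding J_def by auto
  define K where "K = P\<^sup>T * P"
  have K: "K \<in> carrier_mat n n" using PQ by (simp add: K_def)
  have AP: "A * P = P * J"
  proof -
    have "A * P = P * J * (Q * P)" unfolding PQ(3) using PQ(5-7)
      by (simp add: assoc_mult_mat[of _ n n _ n _ n] mult_carrier_mat[of _ n n _ n])
    thus ?thesis using PQ(2,5,6) by simp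
  qed
  have comm: "K * J = J\<^sup>T * K"
  proof -
    have "K * J = P\<^sup>T * (A * P)" unfolding AP K_def using PQ(5,6) by simp
    also have "\<dots> = (A * P)\<^sup>T * P"
      using PQ(6) A by (simp add: transpose_mult[OF A(1) PQ(6)])
    also have "\<dots> = J\<^sup>T * K" unfolding AP K_def using PQ(5,6) by (simp add: transpose_mult[OF PQ(6,5)])
    finally show ?thesis .
  qed
  have Kpos: "K $$ (i, i) \<noteq> 0" if i: "i < n" for i
  proof
    assume "K $$ (i, i) = 0"
    hence "col P i \<bullet> col P i = 0" using i PQ by (simp add: K_def)
    hence "col P i = 0\<^sub>v n" using i PQ(6) real_scalar_prod_self(2)[of "col P i" n] by simp
    thus False using invertible_mat_col_nonzero[OF PQ(6,7,2) i] by simp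
  qed
  have bidiag: "J $$ (i, j) = 0" if "i < n" "j < n" "i \<noteq> j" "j \<noteq> Suc i" for i j
    using jordan_matrix_bidiagonal[of i n_as j] that unfolding J_def n by blast
  \<comment> \<open>Induction on \<open>i\<close>: at the least \<open>i\<close> with a nonzero entry above the diagonal, column \<open>i\<close> of \<open>J\<close> is zero off the diagonal.\<close>
  have superdiag: "J $$ (i, Suc i) = 0" if "Suc i < n" for i
    using that
  proof (induction i rule: less_induct)
    case (less i)
    show ?case
    proof (rule ccontr)
      assume nz: "J $$ (i, Suc i) \<noteq> 0"
      have eq: "J $$ (i, i) = J $$ (Suc i, Suc i)"
        using jordan_matrix_bidiagonal[of i n_as "Suc i"] nz less.prems
        unfolding J_def n by (metis Suc_lessD n_not_Suc_n)
      have "(K * J) $$ (i, Suc i) = (\<Sum>k = 0..<n. K $$ (i, k) * J $$ (k, Suc i))"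
        using less.prems K PQ by (simp add: scalar_prod_def)
      also have "\<dots> = (\<Sum>k\<in>{i, Suc i}. K $$ (i, k) * J $$ (k, Suc i))"
        using less.prems by (intro sum.mono_neutral_right) (auto simp: bidiag)
      finally have l: "(K * J) $$ (i, Suc i)
        = K $$ (i, i) * J $$ (i, Suc i) + K $$ (i, Suc i) * J $$ (Suc i, Suc i)" by simp
      have "(J\<^sup>T * K) $$ (i, Suc i) = (\<Sum>k = 0..<n. J $$ (k, i) * K $$ (k, Suc i))"
        using less.prems K PQ by (simp add: scalar_prod_def)
      also have "\<dots> = (\<Sum>k\<in>{i}. J $$ (k, i) * K $$ (k, Suc i))"
      proof (intro sum.mono_neutral_right ballI)
        fix k assume "k \<in> {0..<n} - {i}"
        hence "J $$ (k, i) = 0"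
          using less.prems less.IH[of k] bidiag[of k i] by (cases "i = Suc k") auto
        thus "J $$ (k, i) * K $$ (k, Suc i) = 0" by simp
      qed (use less.prems in auto)
      finally have "(J\<^sup>T * K) $$ (i, Suc i) = J $$ (i, i) * K $$ (i, Suc i)" by simp
      hence "K $$ (i, i) * J $$ (i, Suc i) = 0" using l unfolding comm eq by simp
      with nz Kpos[of i] less.prems show False by simp
    qed
  qed
  have "J = mat_diag n (\<lambda>i. J $$ (i, i))"
  proof (rule eq_matI)
    fix i j assume "i < dim_row (mat_diag n (\<lambda>i. J $$ (i, i)))" "j < dim_col (mat_diag n (\<lambda>i. J $$ (i, i)))"
    hence ij: "i < n" "j < n" by (auto simp: mat_diag_def)
    thus "J $$ (i, j) = mat_diag n (\<lambda>i. J $$ (i, i)) $$ (i, j)"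
      using bidiag[of i j] superdiag[of i] by (cases "j = Suc i") (auto simp: mat_diag_def)
  qed (use PQ(5) in \<open>auto simp: mat_diag_def\<close>)
  with PQ(3) have "A = P * mat_diag n (\<lambda>i. J $$ (i, i)) * Q" by simp
  with PQ(1,2,6,7) show ?thesis by blast
qed

section \<open>Matrices sharing a diagonalization\<close>

lemma mat_diag_sandwich_mult:
  fixes A :: "'a :: semiring_1 mat"
  assumes "A \<in> carrier_mat n n" "B \<in> carrier_mat n n" "B' \<in> carrier_mat n n" "C \<in> carrier_mat n n"
    and "B * B' = 1\<^sub>m n"
  shows "(A * mat_diag n f * B) * (B' * mat_diag n g * C) = A * mat_diag n (\<lambda>i. f i * g i) * C"
proof -
  note as = assoc_mult_mat[of _ n n _ n _ n] mult_carrier_mat[of _ n n _ n]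
    left_mult_one_mat[of _ n n] right_mult_one_mat[of _ n n]
  have D: "mat_diag n f \<in> carrier_mat n n" "mat_diag n g \<in> carrier_mat n n" by simp_all
  have "(A * mat_diag n f * B) * (B' * mat_diag n g * C) = A * mat_diag n f * ((B * B') * (mat_diag n g * C))"
    using assms(1-4) D by (simp add: as)
  also have "\<dots> = A * (mat_diag n f * mat_diag n g) * C"
    unfolding assms(5) using assms(1-4) by (simp add: as del: mat_diag_diag)
  finally show ?thesis by simp
qed

text \<open>For a diagonal matrix \<open>D\<close>, the matrix \<open>P D P\<inverse>\<close> is symmetric if and only if \<open>D\<close> commutes
with \<open>K = P\<^sup>T P\<close>, which says that \<open>K\<close> has zero entries wherever two diagonal values of \<open>D\<close>
differ. Applying \<open>f\<close> to the diagonal values preserves this.\<close>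

lemma symmetric_mat_diag_function:
  fixes d :: "nat \<Rightarrow> real"
  assumes c: "P \<in> carrier_mat n n" "Q \<in> carrier_mat n n" "P * Q = 1\<^sub>m n" "Q * P = 1\<^sub>m n"
    and sym: "(P * mat_diag n d * Q)\<^sup>T = P * mat_diag n d * Q"
  shows "(P * mat_diag n (\<lambda>i. f (d i)) * Q)\<^sup>T = P * mat_diag n (\<lambda>i. f (d i)) * Q"
proof -
  define K where "K = P\<^sup>T * P"
  have K: "K \<in> carrier_mat n n" using c by (simp add: K_def)
  have dT: "(mat_diag n g)\<^sup>T = mat_diag n g" for g :: "nat \<Rightarrow> real"
    by (intro eq_matI) (auto simp: mat_diag_def)
  have QTPT: "P\<^sup>T * Q\<^sup>T = 1\<^sub>m n" "Q\<^sup>T * P\<^sup>T = 1\<^sub>m n"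
    using transpose_mult[OF c(2,1)] transpose_mult[OF c(1,2)] unfolding c(3,4) transpose_one by metis+
  have key: "(P * mat_diag n g * Q)\<^sup>T = P * mat_diag n g * Q \<longleftrightarrow> mat_diag n g * K = K * mat_diag n g"
    for g :: "nat \<Rightarrow> real"
  proof -
    let ?D = "mat_diag n g"
    have D: "?D \<in> carrier_mat n n" by simp
    note as = assoc_mult_mat[of _ n n _ n _ n] mult_carrier_mat[of _ n n _ n]
    left_mult_one_mat[of _ n n] right_mult_one_mat[of _ n n]
    have tr: "(P * ?D * Q)\<^sup>T = Q\<^sup>T * ?D * P\<^sup>T"
      using c D by (simp add: transpose_mult[of _ n n _ n] dT as)
    have l: "P\<^sup>T * (Q\<^sup>T * ?D * P\<^sup>T) * P = ?D * K"
    proof -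
      have "P\<^sup>T * (Q\<^sup>T * ?D * P\<^sup>T) * P = (P\<^sup>T * Q\<^sup>T) * (?D * (P\<^sup>T * P))" using c D by (simp add: as)
      thus ?thesis using QTPT D K by (simp add: K_def)
    qed
    have r: "P\<^sup>T * (P * ?D * Q) * P = K * ?D"
    proof -
      have "P\<^sup>T * (P * ?D * Q) * P = (P\<^sup>T * P) * (?D * (Q * P))" using c D by (simp add: as)
      thus ?thesis using c D K by (simp add: K_def as)
    qed
    have l': "Q\<^sup>T * (?D * K) * Q = Q\<^sup>T * ?D * P\<^sup>T"
    proof -
      have "Q\<^sup>T * (?D * K) * Q = Q\<^sup>T * ?D * (P\<^sup>T * (P * Q))" using c D by (simp add: K_def as)
      thus ?thesis using c D by (simp add: as)
    qed
    have r': "Q\<^sup>T * (K * ?D) * Q = P * ?D * Q"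
    proof -
      have "Q\<^sup>T * (K * ?D) * Q = (Q\<^sup>T * P\<^sup>T) * (P * (?D * Q))" using c D by (simp add: K_def as)
      thus ?thesis using c D QTPT by (simp add: as)
    qed
    show ?thesis unfolding tr using l r l' r' by metis
  qed
  have e: "(mat_diag n g * K = K * mat_diag n g) \<longleftrightarrow> (\<forall>i<n. \<forall>j<n. g i = g j \<or> K $$ (i, j) = 0)"
    for g :: "nat \<Rightarrow> real"
    unfolding mat_diag_mult_left[OF K] mat_diag_mult_right[OF K] by (auto simp: mat_eq_iff)
  show ?thesis using sym unfolding key e by metis
qed


lemma mat_diag_similar_mult_col:
  fixes d :: "nat \<Rightarrow> 'a :: comm_ring_1"
  assumes c: "P \<in> carrier_mat n n" "Q \<in> carrier_mat n n" "Q * P = 1\<^sub>m n" and i: "i < n"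
  shows "(P * mat_diag n d * Q) *\<^sub>v col P i = d i \<cdot>\<^sub>v col P i"
proof -
  have D: "mat_diag n d \<in> carrier_mat n n" by simp
  have "(P * mat_diag n d * Q) * P = P * mat_diag n d * (Q * P)"
    using c(1,2) D by (simp add: assoc_mult_mat[of _ n n _ n _ n] mult_carrier_mat[of _ n n _ n])
  also have "\<dots> = P * mat_diag n d"
    using c D by (simp add: right_mult_one_mat[of _ n n] mult_carrier_mat[of _ n n _ n])
  finally have "(P * mat_diag n d * Q) *\<^sub>v col P i = col (P * mat_diag n d) i"
    using c(1,2) D i by (metis col_mult2 mult_carrier_mat)
  also have "\<dots> = d i \<cdot>\<^sub>v col P i"
    using c(1) i by (intro eq_vecI) (auto simp: mat_diag_mult_right[OF c(1)] mult.commute)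
  finally show ?thesis .
qed

section \<open>The principal square root\<close>

text \<open>Apply the square root to the diagonal values, which are nonnegative. The result is positive
semidefinite because it is itself the square of a symmetric matrix, built from the fourth roots.\<close>

lemma pos_semidef_sqrt_exists:
  assumes A: "sym_pos_semidef n A"
  shows "\<exists>R. sym_pos_semidef n R \<and> R * R = A"
proof -
  have Ac: "A \<in> carrier_mat n n" "A\<^sup>T = A" and psd: "\<And>x. x \<in> carrier_vec n \<Longrightarrow> 0 \<le> x \<bullet> (A *\<^sub>v x)"
    using A by (auto simp: sym_pos_semidef_def)
  obtain P Q d where c: "P \<in> carrier_mat n n" "Q \<in> carrier_mat n n" "P * Q = 1\<^sub>m n" "Q * P = 1\<^sub>m n"
    and A_eq: "A = P * mat_diag n d * Q"
    using symmetric_diagonalizable[OF Ac] by blast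
  have d: "0 \<le> d i" if i: "i < n" for i
  proof -
    have p: "col P i \<in> carrier_vec n" using c(1) i by (intro col_carrier_vec)
    have "0 \<le> d i * (col P i \<bullet> col P i)"
      using psd[OF p] mat_diag_similar_mult_col[OF c(1,2,4) i, of d] p by (simp add: A_eq)
    moreover have "col P i \<bullet> col P i > 0"
      using real_scalar_prod_self(1)[of "col P i"] real_scalar_prod_self(2)[OF p]
        invertible_mat_col_nonzero[OF c(1,2,4) i] by linarith
    ultimately show ?thesis by (simp add: zero_le_mult_iff)
  qed
  define F where "F f = P * mat_diag n (\<lambda>i. f (d i)) * Q" for f :: "real \<Rightarrow> real"
  have F: "F f \<in> carrier_mat n n" "(F f)\<^sup>T = F f" for f
    using c symmetric_mat_diag_function[OF c, of d f] Ac(2) by (auto simp: F_def A_eq mult_carrier_mat[of _ n n])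
  have mult: "F f * F g = F (\<lambda>x. f x * g x)" for f g
    unfolding F_def by (rule mat_diag_sandwich_mult[OF c(1,2,1,2,4)])
  have cong: "F f = F g" if "\<And>x. 0 \<le> x \<Longrightarrow> f x = g x" for f g
  proof -
    have "mat_diag n (\<lambda>i. f (d i)) = mat_diag n (\<lambda>i. g (d i))"
      using d that by (intro eq_matI) (auto simp: mat_diag_def)
    thus ?thesis by (simp add: F_def)
  qed
  define R where "R = F sqrt"
  define B where "B = F (\<lambda>x. sqrt (sqrt x))"
  have "R = B * B" unfolding R_def B_def mult by (rule cong) simp
  have "0 \<le> x \<bullet> (R *\<^sub>v x)" if x: "x \<in> carrier_vec n" for x
  proof -
    have Bc: "B \<in> carrier_mat n n" "B\<^sup>T = B" unfolding B_def by (rule F)+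
    have "x \<bullet> (R *\<^sub>v x) = x \<bullet> (B *\<^sub>v (B *\<^sub>v x))" unfolding \<open>R = B * B\<close> using Bc x by simp
    also have "\<dots> = (B *\<^sub>v x) \<bullet> (B *\<^sub>v x)" using Bc x by (intro symmetric_mat_self_adjoint) auto
    finally show ?thesis using real_scalar_prod_self(1) by simp
  qed
  moreover have "R * R = A"
  proof -
    have "R * R = F (\<lambda>x. x)" unfolding R_def mult by (rule cong) simp
    thus ?thesis by (simp add: F_def A_eq)
  qed
  moreover have "R \<in> carrier_mat n n" "R\<^sup>T = R" unfolding R_def by (rule F)+
  ultimately show ?thesis by (auto simp: sym_pos_semidef_def)
qed

text \<open>Let \<open>p\<close> be an eigenvector of \<open>D = R - Q\<close> for the eigenvalue \<open>\<delta>\<close>. From \<open>R\<^sup>2 = Q\<^sup>2\<close>,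
\<open>0 = |R p|\<^sup>2 - |Q p|\<^sup>2 = D p \<bullet> (R + Q) p = \<delta> (p \<bullet> R p + p \<bullet> Q p)\<close>.
If \<open>\<delta>\<close> were nonzero, both nonnegative terms would vanish, hence also their difference
\<open>p \<bullet> D p = \<delta> |p|\<^sup>2\<close>. So the diagonalizable matrix \<open>D\<close> has only the eigenvalue zero.\<close>

lemma pos_semidef_sqrt_unique:
  assumes R: "sym_pos_semidef n R" and Q: "sym_pos_semidef n Q" and eq: "R * R = Q * Q"
  shows "R = Q"
proof -
  have Rc: "R \<in> carrier_mat n n" "R\<^sup>T = R" and Rp: "\<And>x. x \<in> carrier_vec n \<Longrightarrow> 0 \<le> x \<bullet> (R *\<^sub>v x)"
    using R by (auto simp: sym_pos_semidef_def)
  have Qc: "Q \<in> carrier_mat n n" "Q\<^sup>T = Q" and Qp: "\<And>x. x \<in> carrier_vec n \<Longrightarrow> 0 \<le> x \<bullet> (Q *\<^sub>v x)"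
    using Q by (auto simp: sym_pos_semidef_def)
  define D where "D = R - Q"
  have Dc: "D \<in> carrier_mat n n" using Rc(1) Qc(1) by (auto simp: D_def)
  have DT: "D\<^sup>T = D"
  proof -
    have "D\<^sup>T = R\<^sup>T - Q\<^sup>T" unfolding D_def using Rc(1) Qc(1) by (intro eq_matI) auto
    thus ?thesis using Rc Qc by (simp add: D_def)
  qed
  obtain U V d where c: "U \<in> carrier_mat n n" "V \<in> carrier_mat n n" "U * V = 1\<^sub>m n" "V * U = 1\<^sub>m n"
    and D_eq: "D = U * mat_diag n d * V"
    using symmetric_diagonalizable[OF Dc DT] by blast
  have "d i = 0" if i: "i < n" for i
  proof (rule ccontr)
    assume di: "d i \<noteq> 0"
    define p where "p = col U i"
    have p: "p \<in> carrier_vec n" "p \<noteq> 0\<^sub>v n" and Dp: "D *\<^sub>v p = d i \<cdot>\<^sub>v p"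
      using c(1) i invertible_mat_col_nonzero[OF c(1,2,4) i] mat_diag_similar_mult_col[OF c(1,2,4) i, of d]
      by (simp_all add: p_def D_eq)
    have Dp': "D *\<^sub>v p = R *\<^sub>v p - Q *\<^sub>v p"
      using Rc Qc p unfolding D_def by (simp add: minus_mult_distrib_mat_vec[of _ n n])
    have v: "R *\<^sub>v p \<in> carrier_vec n" "Q *\<^sub>v p \<in> carrier_vec n" using Rc Qc p by auto
    have "(R *\<^sub>v p) \<bullet> (R *\<^sub>v p) = (Q *\<^sub>v p) \<bullet> (Q *\<^sub>v p)"
    proof -
      have "(R *\<^sub>v p) \<bullet> (R *\<^sub>v p) = p \<bullet> ((R * R) *\<^sub>v p)"
        using symmetric_mat_self_adjoint[OF Rc p(1) v(1)] Rc p by simp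
      also have "\<dots> = (Q *\<^sub>v p) \<bullet> (Q *\<^sub>v p)"
        unfolding eq using symmetric_mat_self_adjoint[OF Qc p(1) v(2)] Qc p by simp
      finally show ?thesis .
    qed
    hence "(R *\<^sub>v p - Q *\<^sub>v p) \<bullet> (R *\<^sub>v p + Q *\<^sub>v p) = 0"
      using v comm_scalar_prod[OF v]
      by (simp add: scalar_prod_add_distrib[where n = n] minus_scalar_prod_distrib[where n = n])
    hence "d i * (p \<bullet> (R *\<^sub>v p) + p \<bullet> (Q *\<^sub>v p)) = 0"
      unfolding Dp'[symmetric] Dp using v p(1) by (simp add: scalar_prod_add_distrib[where n = n] distrib_left)
    hence z: "p \<bullet> (R *\<^sub>v p) = 0" "p \<bullet> (Q *\<^sub>v p) = 0" using di Rp[OF p(1)] Qp[OF p(1)] by auto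
    have "d i * (p \<bullet> p) = p \<bullet> (D *\<^sub>v p)" unfolding Dp using p by simp
    also have "\<dots> = 0" unfolding Dp' using z v p by (simp add: scalar_prod_minus_distrib[where n = n])
    finally show False using di p real_scalar_prod_self(2)[OF p(1)] by simp
  qed
  hence "mat_diag n d = 0\<^sub>m n n" by (intro eq_matI) (auto simp: mat_diag_def)
  hence "D = 0\<^sub>m n n" using c by (simp add: D_eq)
  hence zero: "(R - Q) $$ (i, j) = 0" if "i < n" "j < n" for i j using that by (simp add: D_def)
  show ?thesis
  proof (rule eq_matI)
    fix i j assume "i < dim_row Q" "j < dim_col Q"
    thus "R $$ (i, j) = Q $$ (i, j)" using zero[of i j] Rc(1) Qc(1) by auto
  qed (use Rc(1) Qc(1) in auto)
qed

lemma mat_sqrt: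
  assumes "sym_pos_semidef n A"
  shows "sym_pos_semidef n (mat_sqrt A)" "mat_sqrt A * mat_sqrt A = A"
proof -
  have n: "dim_row A = n" using assms by (auto simp: sym_pos_semidef_def)
  have "\<exists>!R. sym_pos_semidef (dim_row A) R \<and> R * R = A"
    unfolding n using pos_semidef_sqrt_exists[OF assms] pos_semidef_sqrt_unique by metis
  from theI'[OF this] show "sym_pos_semidef n (mat_sqrt A)" "mat_sqrt A * mat_sqrt A = A"
    unfolding mat_sqrt_def n by auto
qed

lemma mat_inv_eqI:
  assumes A: "A \<in> carrier_mat n n" and B: "B \<in> carrier_mat n n" and AB: "A * B = 1\<^sub>m n"
  shows "mat_inv A = B"
proof (cases "mat_inverse A")
  case None
  have "B * A = 1\<^sub>m n" by (rule mat_mult_left_right_inverse[OF A B AB])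
  hence "A \<in> Units (ring_mat TYPE(real) n ())" using A B AB by (auto simp: Units_def ring_mat_def)
  with mat_inverse(1)[OF A None, of "()"] show ?thesis by blast
next
  case (Some C)
  from mat_inverse(2)[OF A Some] have C: "C * A = 1\<^sub>m n" "C \<in> carrier_mat n n" by auto
  have "C = C * (A * B)" using C AB by simp
  also have "\<dots> = (C * A) * B" using A B C(2) by simp
  finally show ?thesis using B C Some by (simp add: mat_inv_def)
qed

section \<open>Reduction of the iteration matrix to diagonal form\<close>

lemma char_poly_mat_diag:
  "char_poly (mat_diag n d) = (\<Prod>i<n. [:- d i, 1:])" for d :: "nat \<Rightarrow> 'a :: field"
proof -
  have "diag_mat (mat_diag n d) = map d [0..<n]" by (auto simp: diag_mat_def mat_diag_def)
  moreover have "upper_triangular (mat_diag n d)" by (auto simp: mat_diag_def)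
  ultimately have "char_poly (mat_diag n d) = (\<Prod>i\<leftarrow>[0..<n]. [:- d i, 1:])"
    by (subst char_poly_upper_triangular[where n = n]) (simp_all add: o_def)
  also have "\<dots> = (\<Prod>i<n. [:- d i, 1:])"
    by (subst prod.distinct_set_conv_list[symmetric]) (simp_all add: atLeast_upt)
  finally show ?thesis .
qed

lemma mat_inv_diag_sandwich:
  fixes f :: "nat \<Rightarrow> real"
  assumes c: "Z \<in> carrier_mat n n" "Z' \<in> carrier_mat n n" "V \<in> carrier_mat n n" "V' \<in> carrier_mat n n"
    and inv: "Z * Z' = 1\<^sub>m n" "V * V' = 1\<^sub>m n" and f: "\<And>i. i < n \<Longrightarrow> f i \<noteq> 0"
  shows "mat_inv (Z * mat_diag n f * V) = V' * mat_diag n (\<lambda>i. 1 / f i) * Z'"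
proof (rule mat_inv_eqI)
  have "mat_diag n (\<lambda>i. f i * (1 / f i)) = 1\<^sub>m n" using f by (intro eq_matI) (auto simp: mat_diag_def)
  thus "(Z * mat_diag n f * V) * (V' * mat_diag n (\<lambda>i. 1 / f i) * Z') = 1\<^sub>m n"
    using mat_diag_sandwich_mult[OF c(1,3,4,2) inv(2), of f "\<lambda>i. 1 / f i"] c inv by simp
qed (use c in \<open>simp_all add: mult_carrier_mat[of _ n n _ n]\<close>)

text \<open>With \<open>R\<close> the square root of \<open>W\<close> and \<open>S = R\<inverse> T R\<inverse> = P \<Delta> P\<inverse>\<close>, take \<open>Z = R P\<close> and
\<open>V = P\<inverse> R\<close>. These outer factors cancel in products that alternate matrices from the pencil with
inverses of such matrices, and the clause on \<open>char_poly\<close> ties the diagonal values to the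
spectrum of \<open>S\<close>.\<close>

lemma pencil_simultaneous_diagonalization:
  assumes W: "sym_pos_def n W" and T: "sym_pos_semidef n T"
  obtains Z Z' V V' d where
    "Z \<in> carrier_mat n n" "Z' \<in> carrier_mat n n" "V \<in> carrier_mat n n" "V' \<in> carrier_mat n n"
    "Z * Z' = 1\<^sub>m n" "V * V' = 1\<^sub>m n" "V' * V = 1\<^sub>m n"
    "W = Z * V" "T = Z * mat_diag n d * V"
    "char_poly (mat_inv (mat_sqrt W) * T * mat_inv (mat_sqrt W)) = (\<Prod>i<n. [:- d i, 1:])"
proof -
  note as = assoc_mult_mat[of _ n n _ n _ n] mult_carrier_mat[of _ n n _ n]
    left_mult_one_mat[of _ n n] right_mult_one_mat[of _ n n]
  have Wc: "W \<in> carrier_mat n n" and Tc: "T \<in> carrier_mat n n" "T\<^sup>T = T"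
    using W T by (auto simp: sym_pos_def_def sym_pos_semidef_def)
  have "sym_pos_semidef n W"
    unfolding sym_pos_semidef_def
  proof (intro conjI ballI)
    fix x :: "real vec" assume x: "x \<in> carrier_vec n"
    show "0 \<le> x \<bullet> (W *\<^sub>v x)"
      using W x by (cases "x = 0\<^sub>v n") (auto simp: sym_pos_def_def less_imp_le)
  qed (use W in \<open>auto simp: sym_pos_def_def\<close>)
  note sqrt = mat_sqrt[OF this]
  define R where "R = mat_sqrt W"
  have R: "R \<in> carrier_mat n n" "R\<^sup>T = R" "R * R = W"
    using sqrt by (auto simp: R_def sym_pos_semidef_def)
  \<comment> \<open>The inverse of \<open>R\<close>, since \<open>R * R = W\<close>.\<close>
  define X where "X = R * mat_inv W"
  have X: "X \<in> carrier_mat n n" using R sym_pos_def_mat_inv(1)[OF W] by (simp add: X_def)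
  have RX: "R * X = 1\<^sub>m n"
  proof -
    have "R * X = (R * R) * mat_inv W" unfolding X_def
      using R(1) sym_pos_def_mat_inv(1)[OF W] by (simp add: as)
    thus ?thesis unfolding R(3) sym_pos_def_mat_inv(2)[OF W] .
  qed
  have XR: "X * R = 1\<^sub>m n" by (rule mat_mult_left_right_inverse[OF R(1) X RX])
  have XT: "X\<^sup>T = X"
  proof -
    have one: "X\<^sup>T * R = 1\<^sub>m n" using transpose_mult[OF R(1) X] unfolding RX R(2) by simp
    have "X\<^sup>T = X\<^sup>T * (R * X)" unfolding RX using X by simp
    also have "\<dots> = (X\<^sup>T * R) * X" using X R(1) by (simp add: as)
    finally show ?thesis unfolding one using X by simp
  qed
  have inv_R: "mat_inv (mat_sqrt W) = X"
    unfolding R_def[symmetric] by (rule mat_inv_eqI[OF R(1) X RX])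
  define S where "S = X * T * X"
  have Sc: "S \<in> carrier_mat n n" using X Tc by (simp add: S_def as)
  have ST: "S\<^sup>T = S" unfolding S_def
    using X Tc XT by (simp add: as transpose_mult[of _ n n _ n])
  obtain P Q d where c: "P \<in> carrier_mat n n" "Q \<in> carrier_mat n n" "P * Q = 1\<^sub>m n" "Q * P = 1\<^sub>m n"
    and S_eq: "S = P * mat_diag n d * Q"
    using symmetric_diagonalizable[OF Sc ST] by blast
  have PQ: "P * (Q * M) = M" if "M \<in> carrier_mat n n" for M
    using that assoc_mult_mat[OF c(1,2) that] c(3) by simp
  have QP: "Q * (P * M) = M" if "M \<in> carrier_mat n n" for M
    using that assoc_mult_mat[OF c(2,1) that] c(4) by simp
  have RX': "R * (X * M) = M" if "M \<in> carrier_mat n n" for M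
    using that assoc_mult_mat[OF R(1) X that] RX by simp
  have XR': "X * (R * M) = M" if "M \<in> carrier_mat n n" for M
    using that assoc_mult_mat[OF X R(1) that] XR by simp
  show ?thesis
  proof (rule that)
    show "R * P \<in> carrier_mat n n" "Q * X \<in> carrier_mat n n" "Q * R \<in> carrier_mat n n" "X * P \<in> carrier_mat n n"
      using R X c by simp_all
    show "(R * P) * (Q * X) = 1\<^sub>m n" "(Q * R) * (X * P) = 1\<^sub>m n" "(X * P) * (Q * R) = 1\<^sub>m n"
      using R(1) X c by (simp_all add: as PQ QP RX' XR' RX XR)
    show "W = (R * P) * (Q * R)" using R c by (simp add: as PQ)
    have "T = R * S * R" unfolding S_def using R(1) X Tc(1) by (simp add: as RX' XR XR')
    also have "\<dots> = (R * P) * mat_diag n d * (Q * R)" unfolding S_eq using R(1) c by (simp add: as)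
    finally show "T = (R * P) * mat_diag n d * (Q * R)" .
    have "similar_mat S (mat_diag n d)"
      by (rule similar_matI[of _ _ P Q n]) (use Sc c S_eq in auto)
    thus "char_poly (mat_inv (mat_sqrt W) * T * mat_inv (mat_sqrt W)) = (\<Prod>i<n. [:- d i, 1:])"
      unfolding inv_R S_def[symmetric] by (simp add: char_poly_similar char_poly_mat_diag)
  qed
qed

section \<open>The scalar estimate and convergence\<close>

text \<open>With \<open>N\<close> the numerator and \<open>D\<close> the denominator, both \<open>D - N\<close> and \<open>D + N\<close> are positive.
For \<open>m > 1\<close> the bound on \<open>\<beta>\<close> enters \<open>D + N\<close> in the form \<open>m\<^sup>2 - 1 < 2 m \<beta>\<close>.\<close>

lemma ttscsp_factor_less_1:
  fixes \<alpha> \<beta> m :: real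
  assumes \<beta>\<alpha>: "0 < \<beta>" "\<beta> < \<alpha>" and m: "0 \<le> m" and \<beta>: "1 < m \<Longrightarrow> \<beta> > 1 / 2 * (m - 1 / m)"
  shows "\<bar>(m - \<beta>) * (1 - \<alpha> * m) / ((1 + \<beta> * m) * (\<alpha> + m))\<bar> < 1"
proof -
  define N where "N = (m - \<beta>) * (1 - \<alpha> * m)"
  define D where "D = (1 + \<beta> * m) * (\<alpha> + m)"
  have D: "0 < D" unfolding D_def using \<beta>\<alpha> m by (intro mult_pos_pos add_pos_nonneg) auto
  have "D - N = (\<alpha> + \<beta>) * (1 + m\<^sup>2)"
    by (simp add: D_def N_def algebra_simps power2_eq_square)
  moreover have "0 < (\<alpha> + \<beta>) * (1 + m\<^sup>2)" using \<beta>\<alpha> by (intro mult_pos_pos add_pos_nonneg) auto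
  ultimately have upper: "N < D" by linarith
  have sum: "D + N = (\<alpha> - \<beta>) * (1 - m\<^sup>2) + 2 * m * (1 + \<alpha> * \<beta>)"
    by (simp add: D_def N_def algebra_simps power2_eq_square)
  have "0 < D + N"
  proof (cases "m \<le> 1")
    case True
    show ?thesis
    proof (cases "m = 0")
      case False
      hence "0 < 2 * m * (1 + \<alpha> * \<beta>)" using \<beta>\<alpha> m by (intro mult_pos_pos add_pos_pos) auto
      moreover have "0 \<le> (\<alpha> - \<beta>) * (1 - m\<^sup>2)" using \<beta>\<alpha> m True by (simp add: power_le_one)
      ultimately show ?thesis unfolding sum by linarith
    qed (use \<beta>\<alpha> in \<open>simp add: sum\<close>)
  next
    case False
    hence "m\<^sup>2 - 1 < 2 * m * \<beta>" using \<beta> by (simp add: field_simps power2_eq_square)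
    hence "(\<alpha> - \<beta>) * (m\<^sup>2 - 1) < (\<alpha> - \<beta>) * (2 * m * \<beta>)" using \<beta>\<alpha> by simp
    also have "\<dots> \<le> 2 * m * (\<alpha> * \<beta>)" using \<beta>\<alpha> m by (simp add: algebra_simps)
    also have "\<dots> < 2 * m * (1 + \<alpha> * \<beta>)" using False by simp
    finally show ?thesis unfolding sum by (simp add: algebra_simps)
  qed
  with upper D show ?thesis unfolding N_def[symmetric] D_def[symmetric] by (simp add: abs_less_iff field_simps)
qed

theorem theorem3:
  fixes W T S :: "real mat" and n s :: nat and \<mu> :: "nat \<Rightarrow> real" and \<alpha> \<beta> :: real
  assumes W: "sym_pos_def n W"
    and T: "sym_pos_semidef n T"
    and S: "S = mat_inv (mat_sqrt W) * T * mat_inv (mat_sqrt W)"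
    and eigenvalues: "char_poly S = (\<Prod>i = 1..n. [:- \<mu> i, 1:])"
    and s: "1 \<le> s" "s \<le> n"
    and zero: "\<forall>i \<in> {1..<s}. \<mu> i = 0"
    and pos: "0 < \<mu> s"
    and sorted: "mono_on {s..n} \<mu>"
    and \<beta>\<alpha>: "0 < \<beta>" "\<beta> < \<alpha>"
    and \<alpha>: "\<alpha> > 1 / 2 * (1 / \<mu> s - \<mu> s)"
    and \<beta>: "\<beta> > 1 / 2 * (\<mu> n - 1 / \<mu> n)"
  shows "ttscsp_convergent W T \<alpha> \<beta>"
proof -
  obtain Z Z' V V' d where
    c: "Z \<in> carrier_mat n n" "Z' \<in> carrier_mat n n" "V \<in> carrier_mat n n" "V' \<in> carrier_mat n n"
    and inv: "Z * Z' = 1\<^sub>m n" "V * V' = 1\<^sub>m n" "V' * V = 1\<^sub>m n"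
    and W_eq: "W = Z * V" and T_eq: "T = Z * mat_diag n d * V"
    and cp: "char_poly S = (\<Prod>i<n. [:- d i, 1:])"
    using pencil_simultaneous_diagonalization[OF W T] unfolding S .
  \<comment> \<open>The diagonal values are among the \<open>\<mu> j\<close>, and \<open>m - 1 / m\<close> is increasing for positive \<open>m\<close>.\<close>
  have d: "0 \<le> d i" "1 < d i \<Longrightarrow> \<beta> > 1 / 2 * (d i - 1 / d i)" if i: "i < n" for i
  proof -
    have "poly (char_poly S) (d i) = 0" unfolding cp using i by (auto simp: poly_prod)
    then obtain j where j: "j \<in> {1..n}" "d i = \<mu> j" unfolding eigenvalues by (auto simp: poly_prod)
    have "d i = 0 \<or> 0 < d i \<and> d i \<le> \<mu> n"
    proof (cases "j < s")
      case False
      hence "\<mu> s \<le> \<mu> j" "\<mu> j \<le> \<mu> n" using j s by (auto intro!: mono_onD[OF sorted])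
      thus ?thesis using pos j by simp
    qed (use zero j in auto)
    moreover have "d i - 1 / d i \<le> \<mu> n - 1 / \<mu> n" if "0 < d i" "d i \<le> \<mu> n"
      using that by (intro diff_mono divide_left_mono) auto
    ultimately show "0 \<le> d i" "1 < d i \<Longrightarrow> \<beta> > 1 / 2 * (d i - 1 / d i)" using \<beta> by auto
  qed
  \<comment> \<open>The four factors of the iteration matrix are matrices of this kind or their inverses.\<close>
  have comb: "a \<cdot>\<^sub>m W + b \<cdot>\<^sub>m T = Z * mat_diag n (\<lambda>i. a + b * d i) * V" for a b
  proof -
    have "mat_diag n (\<lambda>i. a + b * d i) = a \<cdot>\<^sub>m 1\<^sub>m n + b \<cdot>\<^sub>m mat_diag n d"
      by (intro eq_matI) (auto simp: mat_diag_def)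
    thus ?thesis using c by (simp add: W_eq T_eq mult_add_distrib_mat[of _ n n _ n] add_mult_distrib_mat[of _ n n _ _ n]
      mult_smult_distrib[of _ n n _ n] mult_smult_assoc_mat[of _ n n _ n] mult_carrier_mat[of _ n n _ n])
  qed
  have WT: "W \<in> carrier_mat n n" "T \<in> carrier_mat n n"
    using W T by (auto simp: sym_pos_def_def sym_pos_semidef_def)
  define \<kappa> where "\<kappa> i = (d i - \<beta>) * (1 - \<alpha> * d i) / ((1 + \<beta> * d i) * (\<alpha> + d i))" for i
  have G: "ttscsp_iteration_mat W T \<alpha> \<beta> = V' * mat_diag n \<kappa> * V"
  proof -
    have "W + \<beta> \<cdot>\<^sub>m T = Z * mat_diag n (\<lambda>i. 1 + \<beta> * d i) * V"
      "T - \<beta> \<cdot>\<^sub>m W = Z * mat_diag n (\<lambda>i. - \<beta> + 1 * d i) * V"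
      "\<alpha> \<cdot>\<^sub>m W + T = Z * mat_diag n (\<lambda>i. \<alpha> + 1 * d i) * V"
      "W - \<alpha> \<cdot>\<^sub>m T = Z * mat_diag n (\<lambda>i. 1 + - \<alpha> * d i) * V"
      unfolding comb[symmetric] using WT by (auto intro!: eq_matI)
    moreover have "mat_inv (Z * mat_diag n (\<lambda>i. 1 + \<beta> * d i) * V) = V' * mat_diag n (\<lambda>i. 1 / (1 + \<beta> * d i)) * Z'"
      using d(1) \<beta>\<alpha> by (intro mat_inv_diag_sandwich c inv) (smt (verit) mult_nonneg_nonneg)
    moreover have "mat_inv (Z * mat_diag n (\<lambda>i. \<alpha> + 1 * d i) * V) = V' * mat_diag n (\<lambda>i. 1 / (\<alpha> + 1 * d i)) * Z'"
      using d(1) \<beta>\<alpha> by (intro mat_inv_diag_sandwich c inv) (smt (verit))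
    moreover have Z'Z: "Z' * Z = 1\<^sub>m n" by (rule mat_mult_left_right_inverse[OF c(1,2) inv(1)])
    ultimately have "ttscsp_iteration_mat W T \<alpha> \<beta> = V' * mat_diag n
        (\<lambda>i. 1 / (1 + \<beta> * d i) * (- \<beta> + 1 * d i) * (1 / (\<alpha> + 1 * d i)) * (1 + - \<alpha> * d i)) * V"
      unfolding ttscsp_iteration_mat_def
      by (simp only: mat_diag_sandwich_mult[OF c(4,2,1,3) Z'Z] mat_diag_sandwich_mult[OF c(4,3,4,2) inv(2)])
    thus ?thesis by (simp add: \<kappa>_def[abs_def] mult_ac)
  qed
  define G where "G = ttscsp_iteration_mat W T \<alpha> \<beta>"
  have Gc: "G \<in> carrier_mat n n" using c by (simp add: G_def G mult_carrier_mat[of _ n n _ n])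
  have "similar_mat G (mat_diag n \<kappa>)"
    by (rule similar_matI[of _ _ V' V n]) (use Gc c inv G in \<open>auto simp: G_def\<close>)
  hence cpG: "char_poly G = (\<Prod>i<n. [:- \<kappa> i, 1:])" by (simp add: char_poly_similar char_poly_mat_diag)
  have cGc: "cmat G \<in> carrier_mat n n" using Gc by simp
  have "0 < n" using s by simp
  then obtain k where k: "eigenvalue (cmat G) k" "spectral_radius (cmat G) = norm k"
    using spectral_radius_mem_max(1)[OF cGc] by (auto simp: spectrum_def)
  interpret h: map_poly_inj_comm_ring_hom complex_of_real ..
  have "char_poly (cmat G) = (\<Prod>i<n. [:- complex_of_real (\<kappa> i), 1:])"
    by (simp add: of_real_hom.char_poly_hom[OF Gc] cpG h.hom_prod)
  moreover have "poly (char_poly (cmat G)) k = 0" using k(1) eigenvalue_root_char_poly[OF cGc] by simp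
  ultimately obtain i where i: "i < n" "k = complex_of_real (\<kappa> i)" by (auto simp: poly_prod)
  hence "norm k = \<bar>\<kappa> i\<bar>" by simp
  also have "\<dots> < 1" unfolding \<kappa>_def using d[OF i(1)] by (intro ttscsp_factor_less_1 \<beta>\<alpha>)
  finally show ?thesis using k(2) by (simp add: ttscsp_convergent_def G_def)
qed

end
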